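(* Let $\Delta$ be a simplicial tree with a good leaf $F_0$. Then there is an ordering $F_0,F_1,\ldots,F_q$ of all the facets of $\Delta$ (starting with the given $F_0$) such that, writing $\Delta_i=\langle F_0,\ldots,F_i\rangle$: 1. $F_0\cap F_1\supseteq F_0\cap F_2\supseteq\cdots\supseteq F_0\cap F_q$; 2. the facet $F_i$ is a leaf of $\Delta_i$ for $0\le i\le q$; 3. for $1\le i\le q$, the facet $F_{i-1}$ is either a leaf of $\Delta_i$ with the same joint as it has in $\Delta_{i-1}$, or it is the unique joint of $F_i$ in $\Delta_i$; 4. $\Delta_i$ is connected for $0\le i\le q$.
   Context: A simplicial complex $\Delta$ on a finite vertex set is a collection of subsets (faces) containing all singletons and closed under taking subsets; its maximal faces are its facets. $\langle F_1,\ldots,F_r\rangle$ denotes the simplicial complex whose facets are $F_1,\ldots,F_r$. A subcollection of $\Delta$ is a simplicial complex whose facets are also facets of $\Delta$. For a facet $F$, $\Delta\setminus\langle F\rangle$ is the subcollection generated by all facets other than $F$. $\Delta$ is connected if any two facets $F,G$ are joined by a sequence of facets $F=G_1,\ldots,G_r=G$ with $G_s\cap G_{s+1}\neq\emptyset$ for $1\le s<r$. A facet $F$ of $\Delta$ is a leaf if either $F$ is the only facet of $\Delta$, or $F$ intersects $\Delta\setminus\langle F\rangle$ in a face of $\Delta\setminus\langle F\rangle$, i.e. there is a facet $G\ne F$ of $\Delta$ with $F\cap H\subseteq G$ for all facets $H\neq F$ of $\Delta$; any such $G$ is called a joint of $F$. A simplicial forest is a simplicial complex in which every nonempty subcollection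 has a leaf; a simplicial tree is a connected simplicial forest. A good leaf of $\Delta$ is a facet $F$ that is a leaf of every subcollection of $\Delta$ containing $F$. In item 3, "$F_{i-1}$ is a leaf of $\Delta_i$ with the same joint as it has in $\Delta_{i-1}$" means that $F_{i-1}$ has a joint in $\Delta_{i-1}$, and any joint of $F_{i-1}$ in $\Delta_{i-1}$ is also a joint of $F_{i-1}$ in $\Delta_i$. *)

theory Defs
  imports Main
begin

text \<open>The vertex set is explicit; for a given complex it is necessarily \<open>\<Union>\<Delta>\<close>.\<close>

definition simplicial_complex :: "'a set \<Rightarrow> 'a set set \<Rightarrow> bool" where
  "simplicial_complex V \<Delta> \<longleftrightarrow>
     finite V \<and> \<Delta> \<subseteq> Pow V \<and> (\<forall>v\<in>V. {v} \<in> \<Delta>) \<and> (\<forall>F\<in>\<Delta>. \<forall>G. G \<subseteq> F \<longrightarrow> G \<in> \<Delta>)"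

definition facets :: "'a set set \<Rightarrow> 'a set set" where
  "facets \<Delta> = {F \<in> \<Delta>. \<forall>G\<in>\<Delta>. F \<subseteq> G \<longrightarrow> G = F}"

text \<open>\<open>generated {F\<^sub>1, \<dots>, F\<^sub>r}\<close> is \<open>\<langle>F\<^sub>1, \<dots>, F\<^sub>r\<rangle>\<close>. Its facets are the generators
  only if these are pairwise incomparable, as any set of facets of a complex is.\<close>

definition generated :: "'a set set \<Rightarrow> 'a set set" where
  "generated S = {G. \<exists>F\<in>S. G \<subseteq> F}"

definition subcollection :: "'a set set \<Rightarrow> 'a set set \<Rightarrow> bool" where
  "subcollection \<Gamma> \<Delta> \<longleftrightarrow> (\<exists>W. simplicial_complex W \<Gamma>) \<and> facets \<Gamma> \<subseteq> facets \<Delta>"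

definition facet_connected :: "'a set set \<Rightarrow> bool" where
  "facet_connected \<Delta> \<longleftrightarrow>
     (\<forall>F\<in>facets \<Delta>. \<forall>G\<in>facets \<Delta>. \<exists>Gs. Gs \<noteq> [] \<and> set Gs \<subseteq> facets \<Delta> \<and> hd Gs = F \<and> last Gs = G \<and>
        (\<forall>s. Suc s < length Gs \<longrightarrow> Gs ! s \<inter> Gs ! Suc s \<noteq> {}))"

definition joint :: "'a set set \<Rightarrow> 'a set \<Rightarrow> 'a set \<Rightarrow> bool" where
  "joint \<Delta> F G \<longleftrightarrow> F \<in> facets \<Delta> \<and> G \<in> facets \<Delta> \<and> G \<noteq> F \<and>
     (\<forall>H\<in>facets \<Delta>. H \<noteq> F \<longrightarrow> F \<inter> H \<subseteq> G)"

definition leaf :: "'a set set \<Rightarrow> 'a set \<Rightarrow> bool" where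
  "leaf \<Delta> F \<longleftrightarrow> F \<in> facets \<Delta> \<and> (facets \<Delta> = {F} \<or> (\<exists>G. joint \<Delta> F G))"

definition simplicial_forest :: "'a set \<Rightarrow> 'a set set \<Rightarrow> bool" where
  "simplicial_forest V \<Delta> \<longleftrightarrow>
     simplicial_complex V \<Delta> \<and> (\<forall>\<Gamma>. subcollection \<Gamma> \<Delta> \<and> \<Gamma> \<noteq> {} \<longrightarrow> (\<exists>F. leaf \<Gamma> F))"

definition simplicial_tree :: "'a set \<Rightarrow> 'a set set \<Rightarrow> bool" where
  "simplicial_tree V \<Delta> \<longleftrightarrow> simplicial_forest V \<Delta> \<and> facet_connected \<Delta>"

definition good_leaf :: "'a set set \<Rightarrow> 'a set \<Rightarrow> bool" where
  "good_leaf \<Delta> F \<longleftrightarrow>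
     F \<in> facets \<Delta> \<and> (\<forall>\<Gamma>. subcollection \<Gamma> \<Delta> \<and> F \<in> \<Gamma> \<longrightarrow> leaf \<Gamma> F)"

text \<open>\<open>F\<close> is a leaf of \<open>\<Delta>\<close> with the same joint as it has in \<open>\<Delta>'\<close>. In particular
  \<open>F\<close> must have a joint in \<open>\<Delta>'\<close>, so it is not the only facet of \<open>\<Delta>'\<close>.\<close>

definition leaf_with_same_joint :: "'a set set \<Rightarrow> 'a set set \<Rightarrow> 'a set \<Rightarrow> bool" where
  "leaf_with_same_joint \<Delta> \<Delta>' F \<longleftrightarrow>
     leaf \<Delta> F \<and> (\<exists>G. joint \<Delta>' F G) \<and> (\<forall>G. joint \<Delta>' F G \<longrightarrow> joint \<Delta> F G)"

definition unique_joint :: "'a set set \<Rightarrow> 'a set \<Rightarrow> 'a set \<Rightarrow> bool" where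
  "unique_joint \<Delta> F G \<longleftrightarrow> joint \<Delta> F G \<and> (\<forall>G'. joint \<Delta> F G' \<longrightarrow> G' = G)"

lemma facets_generated:
  assumes "S \<subseteq> facets \<Delta>"
  shows "facets (generated S) = S"
  using assms unfolding facets_def generated_def by auto blast+

end

(* Since F_0 is a good leaf, the sets F_0 \<inter> H form a chain under inclusion. The order is built
   from the end: a forest with at least two facets has a leaf L \<noteq> F_0 with F_0 \<inter> L minimal;
   L becomes the last facet, and removing a leaf preserves connectedness. To find L, remove any
   leaf F \<noteq> F_0. If F_0 \<inter> F is not minimal, induction gives a leaf G of the rest with F_0 \<inter> G
   minimal. G can only fail to be a leaf of the whole complex if it is the joint of F, but then
   F_0 \<inter> F \<subseteq> G would force F_0 \<inter> F to be minimal.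
   Item 3 follows from item 2 alone: if some joint G of F_{i-1} in \<Delta>_{i-1} is lost in \<Delta>_i,
   then a joint J \<noteq> F_{i-1} of F_i would give F_{i-1} \<inter> F_i \<subseteq> F_{i-1} \<inter> J \<subseteq> G. *)
theory Submission
  imports Defs
begin

text \<open>Joints, leaves and connectedness depend only on the set of facets, so the argument is
  carried out for families of sets.\<close>

definition family_joint :: "'a set set \<Rightarrow> 'a set \<Rightarrow> 'a set \<Rightarrow> bool" where
  "family_joint S F G \<longleftrightarrow> F \<in> S \<and> G \<in> S \<and> G \<noteq> F \<and> (\<forall>H\<in>S. H \<noteq> F \<longrightarrow> F \<inter> H \<subseteq> G)"

definition family_leaf :: "'a set set \<Rightarrow> 'a set \<Rightarrow> bool" where
  "family_leaf S F \<longleftrightarrow> F \<in> S \<and> (S = {F} \<or> (\<exists>G. family_joint S F G))"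

definition family_forest :: "'a set set \<Rightarrow> bool" where
  "family_forest S \<longleftrightarrow> finite S \<and> (\<forall>T. T \<subseteq> S \<and> T \<noteq> {} \<longrightarrow> (\<exists>F. family_leaf T F))"

definition meeting :: "'a set set \<Rightarrow> ('a set \<times> 'a set) set" where
  "meeting S = {(A, B). A \<in> S \<and> B \<in> S \<and> A \<inter> B \<noteq> {}}"

text \<open>Chains of pairwise meeting facets become a reflexive-transitive closure, so that
  connectedness can be treated by rule induction instead of list indices.\<close>

definition family_connected :: "'a set set \<Rightarrow> bool" where
  "family_connected S \<longleftrightarrow> (\<forall>A\<in>S. \<forall>B\<in>S. (A, B) \<in> (meeting S)\<^sup>*)"

section \<open>Translation between complexes and their families of facets\<close>

lemma joint_eq_family_joint: "joint \<Delta> F G \<longleftrightarrow> family_joint (facets \<Delta>) F G"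
  unfolding joint_def family_joint_def by blast

lemma leaf_eq_family_leaf: "leaf \<Delta> F \<longleftrightarrow> family_leaf (facets \<Delta>) F"
  unfolding leaf_def family_leaf_def joint_eq_family_joint by blast

text \<open>A list is read as a walk along \<open>meeting S\<close>, and a walk is turned into a
  list by appending its vertices. Membership of \<open>A\<close> matters for the walk of length
  zero, whose list is \<open>[A]\<close>.\<close>

lemma meeting_path_iff_rtrancl:
  assumes "A \<in> S"
  shows "(\<exists>Gs. Gs \<noteq> [] \<and> set Gs \<subseteq> S \<and> hd Gs = A \<and> last Gs = B \<and>
            (\<forall>s. Suc s < length Gs \<longrightarrow> Gs ! s \<inter> Gs ! Suc s \<noteq> {}))
         \<longleftrightarrow> (A, B) \<in> (meeting S)\<^sup>*" (is "?path B \<longleftrightarrow> _")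
proof
  assume "?path B"
  then obtain Gs where Gs: "Gs \<noteq> []" "set Gs \<subseteq> S" "hd Gs = A" "last Gs = B"
    "\<And>s. Suc s < length Gs \<Longrightarrow> Gs ! s \<inter> Gs ! Suc s \<noteq> {}" by blast
  have "(A, Gs ! s) \<in> (meeting S)\<^sup>*" if "s < length Gs" for s
    using that
  proof (induction s)
    case 0
    then show ?case using Gs by (simp add: hd_conv_nth)
  next
    case (Suc s)
    have "Gs ! s \<in> S" "Gs ! Suc s \<in> S"
      using Gs(2) Suc.prems by (auto simp: subset_iff)
    then have "(Gs ! s, Gs ! Suc s) \<in> meeting S"
      using Gs(5)[OF Suc.prems] by (simp add: meeting_def)
    moreover have "(A, Gs ! s) \<in> (meeting S)\<^sup>*"
      using Suc by simp
    ultimately show ?case by (rule rtrancl_into_rtrancl[rotated])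
  qed
  from this[of "length Gs - 1"] show "(A, B) \<in> (meeting S)\<^sup>*"
    using Gs(1,4) by (simp add: last_conv_nth)
next
  assume "(A, B) \<in> (meeting S)\<^sup>*"
  then show "?path B"
  proof (induction rule: rtrancl_induct)
    case base
    show ?case using assms by (intro exI[of _ "[A]"]) simp
  next
    case (step B C)
    then obtain Gs where Gs: "Gs \<noteq> []" "set Gs \<subseteq> S" "hd Gs = A" "last Gs = B"
      "\<And>s. Suc s < length Gs \<Longrightarrow> Gs ! s \<inter> Gs ! Suc s \<noteq> {}" by blast
    have BC: "C \<in> S" "B \<inter> C \<noteq> {}" using step.hyps(2) by (auto simp: meeting_def)
    have "(Gs @ [C]) ! s \<inter> (Gs @ [C]) ! Suc s \<noteq> {}" if "Suc s < length (Gs @ [C])" for s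
    proof (cases "Suc s < length Gs")
      case True
      then show ?thesis using Gs(5) by (simp add: nth_append)
    next
      case False
      then have "s = length Gs - 1" "Suc s = length Gs" using that by auto
      then show ?thesis using BC(2) Gs(1,4) by (simp add: nth_append last_conv_nth)
    qed
    then show ?case
      using Gs BC by (intro exI[of _ "Gs @ [C]"]) auto
  qed
qed

lemma facet_connected_iff: "facet_connected \<Delta> \<longleftrightarrow> family_connected (facets \<Delta>)"
  unfolding facet_connected_def family_connected_def
  by (intro ball_cong refl meeting_path_iff_rtrancl)

lemma subcollection_generated:
  assumes "simplicial_complex V \<Delta>" and "S \<subseteq> facets \<Delta>"
  shows "subcollection (generated S) \<Delta>"
proof -
  have "S \<subseteq> Pow V" "finite V"
    using assms unfolding simplicial_complex_def facets_def by auto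
  then have "finite (\<Union>S)" by (meson Sup_le_iff PowD finite_subset subsetD)
  \<comment> \<open>The vertex set shrinks from \<open>V\<close> to \<open>\<Union>S\<close>,
    because every vertex has to be a face.\<close>
  then have "simplicial_complex (\<Union>S) (generated S)"
    unfolding simplicial_complex_def generated_def by blast
  then show ?thesis
    using assms(2) unfolding subcollection_def facets_generated[OF assms(2)] by blast
qed

lemma family_forest_facets:
  assumes "simplicial_forest V \<Delta>"
  shows "family_forest (facets \<Delta>)"
proof -
  have cplx: "simplicial_complex V \<Delta>"
    using assms by (simp add: simplicial_forest_def)
  then have "finite (facets \<Delta>)"
    unfolding simplicial_complex_def facets_def
    by (metis (no_types, lifting) finite_Pow_iff finite_subset mem_Collect_eq subsetI)
  moreover have "\<exists>F. family_leaf T F" if T: "T \<subseteq> facets \<Delta>" "T \<noteq> {}" for T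
  proof -
    have "generated T \<noteq> {}" using T(2) by (auto simp: generated_def)
    then obtain F where "leaf (generated T) F"
      using assms subcollection_generated[OF cplx T(1)] unfolding simplicial_forest_def by blast
    then show ?thesis
      unfolding leaf_eq_family_leaf facets_generated[OF T(1)] ..
  qed
  ultimately show ?thesis by (simp add: family_forest_def)
qed

text \<open>In the subcollection with facets \<open>F\<close>, \<open>A\<close>, \<open>B\<close>
  the good leaf \<open>F\<close> has a joint, which is \<open>A\<close> or \<open>B\<close>; either
  choice gives one of the two inclusions.\<close>

lemma good_leaf_chain:
  assumes "simplicial_complex V \<Delta>" and "good_leaf \<Delta> F" and "A \<in> facets \<Delta>" and "B \<in> facets \<Delta>"
  shows "F \<inter> A \<subseteq> B \<or> F \<inter> B \<subseteq> A"
proof (cases "A = F \<or> B = F")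
  case False
  have sub: "{F, A, B} \<subseteq> facets \<Delta>"
    using assms by (auto simp: good_leaf_def)
  have "F \<in> generated {F, A, B}" by (auto simp: generated_def)
  then have "leaf (generated {F, A, B}) F"
    using assms(2) subcollection_generated[OF assms(1) sub] unfolding good_leaf_def by blast
  then have "family_leaf {F, A, B} F"
    unfolding leaf_eq_family_leaf facets_generated[OF sub] .
  then show ?thesis
    using False unfolding family_leaf_def family_joint_def by blast
qed auto

section \<open>Leaves of forests\<close>

lemma family_forest_subset: "family_forest S \<Longrightarrow> T \<subseteq> S \<Longrightarrow> family_forest T"
  unfolding family_forest_def by (meson finite_subset subset_trans)

text \<open>Only \<open>F\<close> has to be tested anew against \<open>J\<close>. Its part in
  \<open>H\<close> lies in the joint \<open>K\<close>, and \<open>K\<close> is still present in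
  \<open>S - {F}\<close> and differs from \<open>H\<close>, so
  \<open>H \<inter> F \<subseteq> H \<inter> K \<subseteq> J\<close>.\<close>

lemma family_joint_add_leaf:
  assumes F: "family_joint S F K" and "K \<noteq> H" and H: "family_joint (S - {F}) H J"
  shows "family_joint S H J"
proof -
  have "F \<inter> H \<subseteq> K" using F H by (simp add: family_joint_def)
  moreover have "H \<inter> K \<subseteq> J" using F H \<open>K \<noteq> H\<close> by (simp add: family_joint_def)
  ultimately have "H \<inter> F \<subseteq> J" by blast
  then show ?thesis using H unfolding family_joint_def by blast
qed

lemma family_joint_imp_leaf: "family_joint S F G \<Longrightarrow> family_leaf S F"
  by (metis family_leaf_def family_joint_def)

lemma family_leaf_joint:
  "family_leaf S F \<Longrightarrow> H \<in> S \<Longrightarrow> H \<noteq> F \<Longrightarrow> \<exists>G. family_joint S F G"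
  unfolding family_leaf_def by blast

text \<open>If the leaf \<open>F\<close> at hand is the forbidden \<open>X\<close>, remove it and
  take a leaf of the rest other than the joint \<open>G\<close> of \<open>F\<close>; such a leaf
  stays a leaf of \<open>S\<close>. The forbidden facet changes from \<open>X\<close> to
  \<open>G\<close>, hence \<open>X\<close> is arbitrary in the induction.\<close>

lemma family_forest_leaf_avoiding:
  assumes "family_forest S" and "A \<in> S" and "B \<in> S" and "A \<noteq> B"
  shows "\<exists>L. L \<noteq> X \<and> family_leaf S L"
proof -
  have "finite S" using assms(1) by (simp add: family_forest_def)
  then show ?thesis using assms
  proof (induction S arbitrary: A B X rule: finite_psubset_induct)
    case (psubset S)
    obtain F where F: "family_leaf S F"
      using psubset.prems unfolding family_forest_def by blast
    show ?case
    proof (cases "F = X")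
      case True
      obtain G where G: "family_joint S F G"
        using F family_leaf_joint psubset.prems by metis
      have inS: "F \<in> S" "G \<in> S" "G \<noteq> F" using G by (auto simp: family_joint_def)
      show ?thesis
      proof (cases "S - {F} = {G}")
        case True
        \<comment> \<open>In a family of two facets each is the joint of the other.\<close>
        then have "family_joint S G F" using inS unfolding family_joint_def by blast
        then show ?thesis using inS(3) \<open>F = X\<close> family_joint_imp_leaf by blast
      next
        case False
        then obtain C where C: "C \<in> S - {F}" "C \<noteq> G" using inS by blast
        have "\<exists>H. H \<noteq> G \<and> family_leaf (S - {F}) H"
          by (rule psubset.IH[of _ C G])
            (use C inS psubset.prems(1) in \<open>auto intro: family_forest_subset\<close>)
        then obtain H where H: "H \<noteq> G" "family_leaf (S - {F}) H" by blast
        then obtain J where J: "family_joint (S - {F}) H J"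
          using inS family_leaf_joint by (metis Diff_iff singletonD)
        have "family_joint S H J"
          by (rule family_joint_add_leaf[OF G _ J]) (use H(1) in simp)
        moreover have "H \<noteq> X" using J \<open>F = X\<close> by (simp add: family_joint_def)
        ultimately show ?thesis using family_joint_imp_leaf by blast
      qed
    qed (use F in blast)
  qed
qed

section \<open>A leaf with minimal trace on the good leaf\<close>

text \<open>Finiteness yields a minimal trace \<open>F \<inter> M\<close>, and the chain condition
  makes it the least one.\<close>

lemma chain_minimal_trace:
  assumes "finite S" and "A \<in> S" and "A \<noteq> F"
    and chain: "\<And>A B. A \<in> S \<Longrightarrow> B \<in> S \<Longrightarrow> F \<inter> A \<subseteq> B \<or> F \<inter> B \<subseteq> A"
  shows "\<exists>M\<in>S. M \<noteq> F \<and> (\<forall>H\<in>S. F \<inter> M \<subseteq> H)"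
proof -
  have "finite ((\<inter>) F ` (S - {F}))" "(\<inter>) F ` (S - {F}) \<noteq> {}"
    using assms by auto
  then obtain m where m: "m \<in> (\<inter>) F ` (S - {F})"
    "\<And>b. b \<in> (\<inter>) F ` (S - {F}) \<Longrightarrow> b \<subseteq> m \<Longrightarrow> m = b"
    using finite_has_minimal by metis
  then obtain M where M: "M \<in> S" "M \<noteq> F" "m = F \<inter> M" by blast
  have "F \<inter> M \<subseteq> H" if "H \<in> S" for H
  proof (cases "H = F")
    case False
    then have "F \<inter> H \<subseteq> F \<inter> M \<Longrightarrow> F \<inter> M = F \<inter> H"
      using m(2)[of "F \<inter> H"] M(3) that by blast
    then show ?thesis using chain[OF M(1) that] by blast
  qed auto
  then show ?thesis using M by blast
qed

text \<open>This finds the last facet of the order: its trace on \<open>F\<^sub>0\<close> lies in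
  every other one, as item 1 demands. The induction removes a leaf \<open>F\<close> whose trace is
  not minimal.\<close>

lemma family_forest_minimal_trace_leaf:
  assumes "family_forest S" and "A \<in> S" and "A \<noteq> F\<^sub>0" and "F\<^sub>0 \<in> S"
    and "\<And>A B. A \<in> S \<Longrightarrow> B \<in> S \<Longrightarrow> F\<^sub>0 \<inter> A \<subseteq> B \<or> F\<^sub>0 \<inter> B \<subseteq> A"
  shows "\<exists>L. L \<noteq> F\<^sub>0 \<and> family_leaf S L \<and> (\<forall>H\<in>S. F\<^sub>0 \<inter> L \<subseteq> H)"
proof -
  have "finite S" using assms(1) by (simp add: family_forest_def)
  then show ?thesis using assms
  proof (induction S arbitrary: A rule: finite_psubset_induct)
    case (psubset S)
    obtain M where M: "M \<in> S" "M \<noteq> F\<^sub>0" "\<And>H. H \<in> S \<Longrightarrow> F\<^sub>0 \<inter> M \<subseteq> H"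
      using chain_minimal_trace[OF psubset.hyps psubset.prems(2,3,5)] by blast
    obtain F where F: "F \<noteq> F\<^sub>0" "family_leaf S F"
      using family_forest_leaf_avoiding[OF psubset.prems(1,2,4,3)] by blast
    show ?case
    proof (cases "\<forall>H\<in>S. F\<^sub>0 \<inter> F \<subseteq> H")
      case False
      \<comment> \<open>Hence \<open>M\<close> survives the removal of \<open>F\<close> and serves
        as the second facet in the induction hypothesis.\<close>
      then have "M \<noteq> F" using M(3) by blast
      have "F \<in> S" using F(2) by (simp add: family_leaf_def)
      have "\<exists>L. L \<noteq> F\<^sub>0 \<and> family_leaf (S - {F}) L \<and> (\<forall>H\<in>S - {F}. F\<^sub>0 \<inter> L \<subseteq> H)"
      proof (rule psubset.IH[of _ M])
        show "family_forest (S - {F})"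
          using psubset.prems(1) by (rule family_forest_subset) blast
        show "F\<^sub>0 \<inter> A \<subseteq> B \<or> F\<^sub>0 \<inter> B \<subseteq> A" if "A \<in> S - {F}" "B \<in> S - {F}" for A B
          using that psubset.prems(5) by simp
      qed (use M(1,2) F(1) \<open>M \<noteq> F\<close> \<open>F \<in> S\<close> psubset.prems(4) in auto)
      then obtain G where G: "G \<noteq> F\<^sub>0" "family_leaf (S - {F}) G"
        "\<And>H. H \<in> S - {F} \<Longrightarrow> F\<^sub>0 \<inter> G \<subseteq> H" by blast
      \<comment> \<open>Comparison with \<open>M\<close> extends the minimality of \<open>G\<close>
        from \<open>S - {F}\<close> to \<open>S\<close>, where \<open>F\<close> itself has to be
        covered.\<close>
      have "F\<^sub>0 \<inter> G \<subseteq> M" using G(3) M(1) \<open>M \<noteq> F\<close> by blast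
      then have min: "\<forall>H\<in>S. F\<^sub>0 \<inter> G \<subseteq> H" using M(3) by blast
      obtain J where J: "family_joint (S - {F}) G J"
        using family_leaf_joint[OF G(2), of F\<^sub>0] G(1) F(1) psubset.prems(4) by auto
      obtain K where K: "family_joint S F K"
        using family_leaf_joint[OF F(2) psubset.prems(4)] F(1) by auto
      have "K \<noteq> G"
      proof
        assume "K = G"
        \<comment> \<open>This is the joint condition of \<open>F\<close> tested against
          \<open>F\<^sub>0\<close>; it would make the trace of \<open>F\<close> minimal too.\<close>
        then have "F\<^sub>0 \<inter> F \<subseteq> G"
          using K F(1) psubset.prems(4) unfolding family_joint_def by blast
        then show False using min False by blast
      qed
      then have "family_joint S G J"
        by (rule family_joint_add_leaf[OF K _ J])
      then have "family_leaf S G" by (rule family_joint_imp_leaf)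
      then show ?thesis using G(1) min by blast
    qed (use F in blast)
  qed
qed

section \<open>Connectedness and construction of the order\<close>

lemma family_connected_remove_leaf:
  assumes "family_connected S" and L: "family_leaf S L"
  shows "family_connected (S - {L})"
  unfolding family_connected_def
proof (intro ballI)
  fix A B assume A: "A \<in> S - {L}" and B: "B \<in> S - {L}"
  obtain G where G: "family_joint S L G"
    using family_leaf_joint[OF L] A by blast
  \<comment> \<open>Replacing \<open>L\<close> by its joint turns paths of \<open>S\<close> into paths of \<open>S - {L}\<close>.\<close>
  define \<phi> where "\<phi> X = (if X = L then G else X)" for X
  have "(A, B) \<in> (meeting S)\<^sup>*"
    using assms(1) A B by (simp add: family_connected_def)
  then have "(A, \<phi> B) \<in> (meeting (S - {L}))\<^sup>*"
  proof (induction rule: rtrancl_induct)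
    case base
    then show ?case using A by (simp add: \<phi>_def)
  next
    case (step X Y)
    \<comment> \<open>Whatever other than \<open>L\<close> meets \<open>L\<close> does so inside
      \<open>G\<close>, hence meets \<open>G\<close>; a step from \<open>L\<close> to
      \<open>G\<close> becomes a loop at \<open>G\<close>.\<close>
    have "X = L \<and> Y = L \<or> (\<phi> X, \<phi> Y) \<in> meeting (S - {L})"
      using step.hyps(2) G unfolding meeting_def family_joint_def \<phi>_def by auto
    then show ?case using step.IH by (auto intro: rtrancl_into_rtrancl)
  qed
  then show "(A, B) \<in> (meeting (S - {L}))\<^sup>*"
    using B by (simp add: \<phi>_def)
qed

text \<open>The forest property, connectedness and the chain condition all survive the removal of
  the leaf \<open>L\<close> with minimal trace, so the rest is ordered by induction and
  \<open>L\<close> is put at the end.\<close>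

lemma family_forest_good_order:
  assumes "family_forest S" and "family_connected S" and "F\<^sub>0 \<in> S"
    and "\<And>A B. A \<in> S \<Longrightarrow> B \<in> S \<Longrightarrow> F\<^sub>0 \<inter> A \<subseteq> B \<or> F\<^sub>0 \<inter> B \<subseteq> A"
  shows "\<exists>(q::nat) F. bij_betw F {0..q} S \<and> F 0 = F\<^sub>0 \<and>
    (\<forall>i<q. F\<^sub>0 \<inter> F (Suc i) \<subseteq> F\<^sub>0 \<inter> F i) \<and>
    (\<forall>i\<le>q. family_leaf (F ` {0..i}) (F i)) \<and>
    (\<forall>i\<le>q. family_connected (F ` {0..i}))"
proof -
  have "finite S" using assms(1) by (simp add: family_forest_def)
  then show ?thesis using assms
  proof (induction S rule: finite_psubset_induct)
    case (psubset S)
    show ?case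
    proof (cases "S = {F\<^sub>0}")
      case True
      then show ?thesis
        using psubset.prems(2)
        by (intro exI[of _ 0] exI[of _ "\<lambda>_. F\<^sub>0"]) (auto simp: bij_betw_def family_leaf_def)
    next
      case False
      then obtain A where "A \<in> S" "A \<noteq> F\<^sub>0" using psubset.prems(3) by blast
      then obtain L where L: "L \<noteq> F\<^sub>0" "family_leaf S L" "\<And>H. H \<in> S \<Longrightarrow> F\<^sub>0 \<inter> L \<subseteq> H"
        using family_forest_minimal_trace_leaf[OF psubset.prems(1) _ _ psubset.prems(3,4), of A]
        by auto
      have "L \<in> S" using L(2) by (simp add: family_leaf_def)
      have "\<exists>(q::nat) F. bij_betw F {0..q} (S - {L}) \<and> F 0 = F\<^sub>0 \<and>
        (\<forall>i<q. F\<^sub>0 \<inter> F (Suc i) \<subseteq> F\<^sub>0 \<inter> F i) \<and>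
        (\<forall>i\<le>q. family_leaf (F ` {0..i}) (F i)) \<and>
        (\<forall>i\<le>q. family_connected (F ` {0..i}))"
      proof (rule psubset.IH)
        show "family_forest (S - {L})"
          using psubset.prems(1) by (rule family_forest_subset) blast
        show "family_connected (S - {L})"
          using psubset.prems(2) L(2) by (rule family_connected_remove_leaf)
        show "F\<^sub>0 \<inter> A \<subseteq> B \<or> F\<^sub>0 \<inter> B \<subseteq> A" if "A \<in> S - {L}" "B \<in> S - {L}" for A B
          using that psubset.prems(4) by simp
      qed (use L(1) \<open>L \<in> S\<close> psubset.prems(3) in auto)
      then obtain q F where F: "bij_betw F {0..q::nat} (S - {L})" "F 0 = F\<^sub>0"
        "\<And>i. i < q \<Longrightarrow> F\<^sub>0 \<inter> F (Suc i) \<subseteq> F\<^sub>0 \<inter> F i"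
        "\<And>i. i \<le> q \<Longrightarrow> family_leaf (F ` {0..i}) (F i)"
        "\<And>i. i \<le> q \<Longrightarrow> family_connected (F ` {0..i})" by blast
      define F' where "F' = F(Suc q := L)"
      \<comment> \<open>Initial segments up to \<open>q\<close> do not change, so their leaves and
        their connectedness carry over; the only new segment is \<open>S\<close> itself.\<close>
      have old: "F' i = F i" "F' ` {0..i} = F ` {0..i}" if "i \<le> q" for i
        using that by (auto simp: F'_def)
      have bij: "bij_betw F' {0..Suc q} S"
      proof -
        have "bij_betw F' {0..q} (S - {L})"
          using F(1) by (rule bij_betw_cong[THEN iffD1, rotated]) (simp add: old)
        moreover have "bij_betw F' {Suc q} {L}" by (simp add: F'_def bij_betw_def)
        ultimately have "bij_betw F' ({0..q} \<union> {Suc q}) ((S - {L}) \<union> {L})"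
          by (rule bij_betw_combine) blast
        then show ?thesis
          using \<open>L \<in> S\<close> by (simp add: atLeast0_atMost_Suc insert_absorb)
      qed
      then have full: "F' ` {0..Suc q} = S" by (simp add: bij_betw_def)
      have top: "F' (Suc q) = L" by (simp add: F'_def)
      have "F\<^sub>0 \<inter> F' (Suc i) \<subseteq> F\<^sub>0 \<inter> F' i" if "i < Suc q" for i
      proof (cases "i = q")
        case True
        have "F' i \<in> S" using full that by auto
        then show ?thesis using L(3) True top by auto
      qed (use that F(3) in \<open>auto simp: old\<close>)
      moreover have "family_leaf (F' ` {0..i}) (F' i)" if "i \<le> Suc q" for i
        using that L(2) F(4) full top old by (cases "i = Suc q") auto
      moreover have "family_connected (F' ` {0..i})" if "i \<le> Suc q" for i
        using that psubset.prems(2) F(5) full old by (cases "i = Suc q") auto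
      ultimately show ?thesis
        using bij F(2) by (intro exI[of _ "Suc q"] exI[of _ F']) (simp add: old)
    qed
  qed
qed

section \<open>The alternative of item 3\<close>

text \<open>Here \<open>A\<close>, \<open>P\<close>, \<open>L\<close> stand for the facets of
  \<Delta>_{i-1}, for F_{i-1} and for F_i. If \<open>A = {P}\<close>, as for i = 1, the second
  alternative holds, since \<open>P\<close> is the only candidate for a joint of
  \<open>L\<close>.\<close>

lemma family_joint_kept_or_unique:
  assumes P: "family_leaf A P" and L: "family_leaf (insert L A) L" "L \<notin> A"
  shows "(family_leaf (insert L A) P \<and> (\<exists>G. family_joint A P G) \<and>
            (\<forall>G. family_joint A P G \<longrightarrow> family_joint (insert L A) P G)) \<or>
         (family_joint (insert L A) L P \<and> (\<forall>G. family_joint (insert L A) L G \<longrightarrow> G = P))"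
    (is "?kept \<or> ?unique")
proof (rule disjCI)
  assume not_unique: "\<not> ?unique"
  have "P \<in> A" "P \<noteq> L" using P L(2) by (auto simp: family_leaf_def)
  then have "\<exists>J. family_joint (insert L A) L J"
    by (intro family_leaf_joint[OF L(1), of P]) simp_all
  \<comment> \<open>Some joint of \<open>L\<close> exists; if all of them were equal to
    \<open>P\<close>, then \<open>P\<close> would be the unique one.\<close>
  then obtain J where J: "family_joint (insert L A) L J" "J \<noteq> P"
    using not_unique by blast
  then have "J \<in> A" by (auto simp: family_joint_def)
  have "L \<inter> P \<subseteq> J" using J(1) \<open>P \<in> A\<close> \<open>P \<noteq> L\<close> by (simp add: family_joint_def)
  have kept: "family_joint (insert L A) P G" if G: "family_joint A P G" for G
  proof -
    have "P \<inter> J \<subseteq> G" using G \<open>J \<in> A\<close> J(2) by (simp add: family_joint_def)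
    then have "P \<inter> L \<subseteq> G" using \<open>L \<inter> P \<subseteq> J\<close> by blast
    then show ?thesis using G by (simp add: family_joint_def)
  qed
  \<comment> \<open>Since \<open>J\<close> is a second member of \<open>A\<close>, the leaf
    \<open>P\<close> is not alone there and has a joint.\<close>
  moreover obtain G where "family_joint A P G"
    using family_leaf_joint[OF P \<open>J \<in> A\<close> J(2)] by blast
  ultimately show ?kept using family_joint_imp_leaf by blast
qed

section \<open>Return to the simplicial complex\<close>

theorem theorem3p4:
  fixes V :: "'a set" and \<Delta> :: "'a set set" and F\<^sub>0 :: "'a set"
  assumes "simplicial_tree V \<Delta>"
    and "good_leaf \<Delta> F\<^sub>0"
  shows "\<exists>(q::nat) F. bij_betw F {0..q} (facets \<Delta>) \<and> F 0 = F\<^sub>0 \<and>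
    (\<forall>i. 1 \<le> i \<and> i < q \<longrightarrow> F 0 \<inter> F i \<supseteq> F 0 \<inter> F (i + 1)) \<and>
    (\<forall>i\<le>q. leaf (generated (F ` {0..i})) (F i)) \<and>
    (\<forall>i. 1 \<le> i \<and> i \<le> q \<longrightarrow>
       leaf_with_same_joint (generated (F ` {0..i})) (generated (F ` {0..i - 1})) (F (i - 1)) \<or>
       unique_joint (generated (F ` {0..i})) (F i) (F (i - 1))) \<and>
    (\<forall>i\<le>q. facet_connected (generated (F ` {0..i})))"
proof -
  have cplx: "simplicial_complex V \<Delta>" and forest: "family_forest (facets \<Delta>)"
    and conn: "family_connected (facets \<Delta>)"
    using assms(1) family_forest_facets
    by (auto simp: simplicial_tree_def simplicial_forest_def facet_connected_iff)
  have "F\<^sub>0 \<in> facets \<Delta>" using assms(2) by (simp add: good_leaf_def)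
  then obtain q F where F: "bij_betw F {0..q::nat} (facets \<Delta>)" "F 0 = F\<^sub>0"
    "\<And>i. i < q \<Longrightarrow> F\<^sub>0 \<inter> F (Suc i) \<subseteq> F\<^sub>0 \<inter> F i"
    "\<And>i. i \<le> q \<Longrightarrow> family_leaf (F ` {0..i}) (F i)"
    "\<And>i. i \<le> q \<Longrightarrow> family_connected (F ` {0..i})"
    using family_forest_good_order[OF forest conn _ good_leaf_chain[OF cplx assms(2)]] by blast
  \<comment> \<open>All \<open>F j\<close> with \<open>j \<le> q\<close> are facets of \<Delta>,
    hence pairwise incomparable, so none is lost among the facets of the generated complex.\<close>
  have facets: "facets (generated (F ` {0..i})) = F ` {0..i}" if "i \<le> q" for i
    using F(1) that by (intro facets_generated[of _ \<Delta>]) (auto simp: bij_betw_def)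
  have "leaf_with_same_joint (generated (F ` {0..i})) (generated (F ` {0..i - 1})) (F (i - 1)) \<or>
        unique_joint (generated (F ` {0..i})) (F i) (F (i - 1))" if i: "1 \<le> i" "i \<le> q" for i
  proof -
    \<comment> \<open>As \<open>1 \<le> i\<close>, the truncated difference \<open>i - 1\<close> is
      the true predecessor of \<open>i\<close>.\<close>
    have ins: "F ` {0..i} = insert (F i) (F ` {0..i - 1})"
      using i(1) by (cases i) (auto simp: atLeast0_atMost_Suc)
    have notin: "F i \<notin> F ` {0..i - 1}"
    proof
      assume "F i \<in> F ` {0..i - 1}"
      then obtain k where k: "k \<le> i - 1" "F i = F k" by auto
      then have "k < i" using i(1) by simp
      then show False
        using k(2) F(1) i(2) inj_onD[of F "{0..q}" i k] by (simp add: bij_betw_def)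
    qed
    have q: "i - 1 \<le> q" using i(2) by simp
    show ?thesis
      unfolding leaf_with_same_joint_def unique_joint_def leaf_eq_family_leaf
        joint_eq_family_joint ins facets[OF i(2), unfolded ins] facets[OF q]
      by (rule family_joint_kept_or_unique[OF F(4)[OF q] F(4)[OF i(2), unfolded ins] notin])
  qed
  moreover have "leaf (generated (F ` {0..i})) (F i)"
    and "facet_connected (generated (F ` {0..i}))" if "i \<le> q" for i
    using F(4,5) that by (simp_all add: leaf_eq_family_leaf facet_connected_iff facets)
  ultimately show ?thesis
    using F(1,2,3) by (intro exI[of _ q] exI[of _ F]) simp
qed

end
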